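(* Let $\mathbb{K}\in\{\mathbb{R},\mathbb{C}\}$. Let $\mathbf{A}, \mathbf{G} \in \mathbb{R}^{k_1 \times \cdots \times k_d \times k_1 \times \cdots \times k_d}$ be the EDMD tensors and $\hat{A}, \hat{G} \in \mathbb{R}^{\hat{k} \times \hat{k}}$, $\hat{k} = \prod_{\mu=1}^d k_\mu$, the EDMD matrices built from the same data $x_1, \dots, x_m$, $y_l = S(x_l)$, and the same set of basis functions (as defined in the context). Suppose that the basis functions can be written in tensor product form, i.e. they are the functions $$\boldsymbol{\psi}^{\mathbf{i}}(x) = \prod_{\mu=1}^d \psi_\mu^{i_\mu}(x_\mu), \qquad \mathbf{i} = (i_1, \dots, i_d), \quad 1 \le i_\mu \le k_\mu,$$ with $\psi_\mu^{i_\mu} : \mathbb{R} \to \mathbb{R}$. Let $\boldsymbol{\xi} \in \mathbb{K}^{k_1 \times \cdots \times k_d}$, let $\xi$ be the row vector in $\mathbb{K}^{\hat{k}}$ obtained by vectorizing $\boldsymbol{\xi}$, and let $\lambda \in \mathbb{K}$. Then $$\boldsymbol{\xi}\mathbf{A} = \lambda\, \boldsymbol{\xi}\mathbf{G} \quad\Leftrightarrow\quad \xi \hat{A} = \lambda\, \xi \hat{G}.$$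
   Context: Setting. Let $S : \mathcal{X} \to \mathcal{X}$, $\mathcal{X} \subseteq \mathbb{R}^d$, be a dynamical system, and let data $x_1, \dots, x_m \in \mathcal{X}$ and $y_l = S(x_l)$, $l = 1, \dots, m$, be given. For each dimension $\mu = 1, \dots, d$ let $\mathcal{D}_\mu = \{\psi_\mu^1, \dots, \psi_\mu^{k_\mu}\}$ be a set of basis functions $\psi_\mu^{i_\mu} : \mathbb{R} \to \mathbb{R}$ (functions of the variable $x_\mu$ only). Index mapping. Each multi-index $\mathbf{i} = (i_1, \dots, i_d)$, $1 \le i_\mu \le k_\mu$, corresponds to the number $$\hat{i} = 1 + \sum_{\mu=1}^d \Big( \prod_{\nu=1}^{\mu-1} k_\nu \Big)(i_\mu - 1) \in \{1, \dots, \hat{k}\}, \qquad \hat{k} = \prod_{\mu=1}^d k_\mu.$$ The vectorization of a tensor $\boldsymbol{\xi}$ of size $k_1 \times \cdots \times k_d$ (a multidimensional array) is the vector $\xi$ of length $\hat{k}$ with $\xi_{\hat{i}} = \boldsymbol{\xi}[i_1, \dots, i_d]$. The basis functions are enumerated by $\psi_{\hat{i}} = \boldsymbol{\psi}^{\mathbf{i}}$. EDMD matrices. With $\Psi = [\psi_1, \dots, \psi_{\hat{k}}]^T$, the vector of all basis functions, $$\hat{A} = \frac{1}{m} \sum_{l=1}^m \Psi(y_l) \Psi(x_l)^T, \qquad \hat{G} = \frac{1}{m} \sum_{l=1}^m \Psi(x_l) \Psi(x_l)^T.$$ EDMD tensors. With $\boldsymbol{\Psi} : \mathbb{R}^d \to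 \mathbb{R}^{k_1 \times \cdots \times k_d}$, $\boldsymbol{\Psi}[i_1, \dots, i_d](x) = \boldsymbol{\psi}^{\mathbf{i}}(x) = \prod_{\mu=1}^d \psi_\mu^{i_\mu}(x_\mu)$, $$\mathbf{A}[i_1, \dots, i_d, j_1, \dots, j_d] = \frac{1}{m} \sum_{l=1}^m \boldsymbol{\Psi}[i_1, \dots, i_d](y_l)\, \boldsymbol{\Psi}[j_1, \dots, j_d](x_l),$$ $$\mathbf{G}[i_1, \dots, i_d, j_1, \dots, j_d] = \frac{1}{m} \sum_{l=1}^m \boldsymbol{\Psi}[i_1, \dots, i_d](x_l)\, \boldsymbol{\Psi}[j_1, \dots, j_d](x_l).$$ Left product. For a tensor operator $\mathbf{A} \in \mathbb{R}^{k_1 \times \cdots \times k_d \times k_1 \times \cdots \times k_d}$, $$(\boldsymbol{\xi}\mathbf{A})[j_1, \dots, j_d] = \sum_{i_1=1}^{k_1} \cdots \sum_{i_d=1}^{k_d} \boldsymbol{\xi}[i_1, \dots, i_d]\, \mathbf{A}[i_1, \dots, i_d, j_1, \dots, j_d],$$ and likewise for $\mathbf{G}$; $\xi\hat{A}$ and $\xi\hat{G}$ are the usual products of a row vector with a matrix. *)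

theory Defs
  imports Complex_Main "HOL-Library.FuncSet" "Jordan_Normal_Form.Matrix"
begin

(* A point of R^d is an element of carrier_vec d. Dimensions, multi-indices, basis functions and
   data are numbered from 1, whereas entries of vec and mat are numbered from 0; hence entry p of
   a vector in the mathematical numbering is entry p - 1 of the corresponding vec. *)

section \<open>Multi-indices and vectorization\<close>

definition multi_indices :: "nat \<Rightarrow> (nat \<Rightarrow> nat) \<Rightarrow> (nat \<Rightarrow> nat) set" where
  "multi_indices d k = (\<Pi>\<^sub>E \<mu>\<in>{1..d}. {1..k \<mu>})"

definition khat :: "nat \<Rightarrow> (nat \<Rightarrow> nat) \<Rightarrow> nat" where
  "khat d k = (\<Prod>\<mu>\<in>{1..d}. k \<mu>)"

definition index_map :: "nat \<Rightarrow> (nat \<Rightarrow> nat) \<Rightarrow> (nat \<Rightarrow> nat) \<Rightarrow> nat" where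
  "index_map d k i = 1 + (\<Sum>\<mu>\<in>{1..d}. (\<Prod>\<nu>\<in>{1..<\<mu>}. k \<nu>) * (i \<mu> - 1))"

(* A tensor of size k_1 x ... x k_d is a function on multi-indices, of which only the values on
   multi_indices d k matter. A tensor operator takes two multi-indices. *)

definition vectorize :: "nat \<Rightarrow> (nat \<Rightarrow> nat) \<Rightarrow> ((nat \<Rightarrow> nat) \<Rightarrow> 'a) \<Rightarrow> 'a vec" where
  "vectorize d k \<xi> =
     vec (khat d k) (\<lambda>n. \<xi> (the_inv_into (multi_indices d k) (index_map d k) (n + 1)))"

lemma khat_Suc: "khat (Suc d) k = khat d k * k (Suc d)"
  by (simp add: khat_def)

lemma index_map_Suc: "index_map (Suc d) k i = index_map d k i + khat d k * (i (Suc d) - 1)"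
  by (simp add: index_map_def khat_def atLeastLessThanSuc_atLeastAtMost)

lemma index_map_bounds:
  assumes "\<forall>\<mu>\<in>{1..d}. i \<mu> \<in> {1..k \<mu>}"
  shows "index_map d k i \<in> {1..khat d k}"
  using assms
proof (induction d)
  case 0
  then show ?case by (simp add: index_map_def khat_def)
next
  case (Suc d)
  then have le: "index_map d k i \<le> khat d k" by simp
  have "i (Suc d) \<in> {1..k (Suc d)}" using Suc.prems by simp
  then obtain c where c: "i (Suc d) = Suc c" "Suc c \<le> k (Suc d)"
    by (cases "i (Suc d)") auto
  have "index_map (Suc d) k i \<le> khat d k * Suc c"
    using le c by (simp add: index_map_Suc)
  also have "\<dots> \<le> khat (Suc d) k" using c by (simp only: khat_Suc mult_le_mono2)
  finally show ?case by (simp add: index_map_def)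
qed

lemma index_map_eqD:
  assumes "\<forall>\<mu>\<in>{1..d}. i \<mu> \<in> {1..k \<mu>}" "\<forall>\<mu>\<in>{1..d}. j \<mu> \<in> {1..k \<mu>}"
    and "index_map d k i = index_map d k j"
  shows "\<forall>\<mu>\<in>{1..d}. i \<mu> = j \<mu>"
  using assms
proof (induction d)
  case 0
  then show ?case by simp
next
  case (Suc d)
  define a b where "a = index_map d k i - 1" and "b = index_map d k j - 1"
  have bnd: "index_map d k i \<in> {1..khat d k}" "index_map d k j \<in> {1..khat d k}"
    by (rule index_map_bounds; use Suc.prems in simp)+
  then have ab: "index_map d k i = Suc a" "index_map d k j = Suc b" "a < khat d k" "b < khat d k"
    by (auto simp: a_def b_def)
  have eq: "a + khat d k * (i (Suc d) - 1) = b + khat d k * (j (Suc d) - 1)"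
    using Suc.prems(3) ab by (simp add: index_map_Suc)
  have mods: "a = b"
    using arg_cong[OF eq, of "\<lambda>t. t mod khat d k"] ab by simp
  then have "i (Suc d) - 1 = j (Suc d) - 1" using eq ab by simp
  moreover have "1 \<le> i (Suc d)" "1 \<le> j (Suc d)" using Suc.prems by auto
  ultimately have "i (Suc d) = j (Suc d)" by simp
  moreover have "\<forall>\<mu>\<in>{1..d}. i \<mu> = j \<mu>"
    using Suc.prems mods ab by (intro Suc.IH) auto
  ultimately show ?case by (auto simp: le_Suc_eq)
qed

lemma bij_betw_index_map: "bij_betw (index_map d k) (multi_indices d k) {1..khat d k}"
proof -
  have inj: "inj_on (index_map d k) (multi_indices d k)"
  proof (rule inj_onI)
    fix i j assume ij: "i \<in> multi_indices d k" "j \<in> multi_indices d k"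
      and eq: "index_map d k i = index_map d k j"
    have "\<forall>\<mu>\<in>{1..d}. i \<mu> = j \<mu>"
      using ij eq by (intro index_map_eqD) (auto simp: multi_indices_def PiE_iff)
    then show "i = j" using ij unfolding multi_indices_def by (intro PiE_ext) auto
  qed
  have sub: "index_map d k ` multi_indices d k \<subseteq> {1..khat d k}"
    using index_map_bounds by (auto simp: multi_indices_def PiE_iff simp del: atLeastAtMost_iff)
  have "card (index_map d k ` multi_indices d k) = khat d k"
    using inj by (simp add: card_image) (simp add: multi_indices_def khat_def card_PiE)
  then have "index_map d k ` multi_indices d k = {1..khat d k}"
    using sub by (intro card_subset_eq) auto
  then show ?thesis using inj by (simp add: bij_betw_def)
qed

(* The defining property of the vectorization. *)
lemma vectorize_index_map:
  assumes "i \<in> multi_indices d k"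
  shows "vectorize d k \<xi> $ (index_map d k i - 1) = \<xi> i"
proof -
  have "index_map d k i \<in> {1..khat d k}"
    using bij_betw_index_map[of d k] assms by (rule bij_betwE[THEN bspec])
  then show ?thesis
    using bij_betw_index_map[of d k] assms
    by (auto simp: vectorize_def bij_betw_def the_inv_into_f_f)
qed

section \<open>EDMD matrices\<close>

(* These are defined for an arbitrary enumerated set of basis functions psi_1, ..., psi_K. *)

definition basis_vec :: "nat \<Rightarrow> (nat \<Rightarrow> real vec \<Rightarrow> real) \<Rightarrow> real vec \<Rightarrow> real vec" where
  "basis_vec K \<psi> x = vec K (\<lambda>n. \<psi> (n + 1) x)"

definition edmd_mat_A ::
    "nat \<Rightarrow> (nat \<Rightarrow> real vec \<Rightarrow> real) \<Rightarrow> nat \<Rightarrow> (nat \<Rightarrow> real vec) \<Rightarrow> (nat \<Rightarrow> real vec) \<Rightarrow> real mat" where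
  "edmd_mat_A K \<psi> m x y = mat K K (\<lambda>(r, c).
     1 / real m * (\<Sum>l\<in>{1..m}. basis_vec K \<psi> (y l) $ r * basis_vec K \<psi> (x l) $ c))"

definition edmd_mat_G ::
    "nat \<Rightarrow> (nat \<Rightarrow> real vec \<Rightarrow> real) \<Rightarrow> nat \<Rightarrow> (nat \<Rightarrow> real vec) \<Rightarrow> real mat" where
  "edmd_mat_G K \<psi> m x = mat K K (\<lambda>(r, c).
     1 / real m * (\<Sum>l\<in>{1..m}. basis_vec K \<psi> (x l) $ r * basis_vec K \<psi> (x l) $ c))"

section \<open>EDMD tensors\<close>

(* Here \<phi> \<mu> p is the p-th basis function of the single variable x_\<mu>. *)
definition basis_tensor ::
    "nat \<Rightarrow> (nat \<Rightarrow> nat \<Rightarrow> real \<Rightarrow> real) \<Rightarrow> (nat \<Rightarrow> nat) \<Rightarrow> real vec \<Rightarrow> real" where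
  "basis_tensor d \<phi> i x = (\<Prod>\<mu>\<in>{1..d}. \<phi> \<mu> (i \<mu>) (x $ (\<mu> - 1)))"

definition edmd_tensor_A ::
    "nat \<Rightarrow> (nat \<Rightarrow> nat \<Rightarrow> real \<Rightarrow> real) \<Rightarrow> nat \<Rightarrow> (nat \<Rightarrow> real vec) \<Rightarrow> (nat \<Rightarrow> real vec)
      \<Rightarrow> (nat \<Rightarrow> nat) \<Rightarrow> (nat \<Rightarrow> nat) \<Rightarrow> real" where
  "edmd_tensor_A d \<phi> m x y i j =
     1 / real m * (\<Sum>l\<in>{1..m}. basis_tensor d \<phi> i (y l) * basis_tensor d \<phi> j (x l))"

definition edmd_tensor_G ::
    "nat \<Rightarrow> (nat \<Rightarrow> nat \<Rightarrow> real \<Rightarrow> real) \<Rightarrow> nat \<Rightarrow> (nat \<Rightarrow> real vec)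
      \<Rightarrow> (nat \<Rightarrow> nat) \<Rightarrow> (nat \<Rightarrow> nat) \<Rightarrow> real" where
  "edmd_tensor_G d \<phi> m x i j =
     1 / real m * (\<Sum>l\<in>{1..m}. basis_tensor d \<phi> i (x l) * basis_tensor d \<phi> j (x l))"

(* Left products of a real or complex tensor, respectively row vector, with a real operator. *)

definition tensor_left_mult ::
    "nat \<Rightarrow> (nat \<Rightarrow> nat) \<Rightarrow> ((nat \<Rightarrow> nat) \<Rightarrow> 'a::real_field) \<Rightarrow> ((nat \<Rightarrow> nat) \<Rightarrow> (nat \<Rightarrow> nat) \<Rightarrow> real)
      \<Rightarrow> (nat \<Rightarrow> nat) \<Rightarrow> 'a" where
  "tensor_left_mult d k \<xi> T j = (\<Sum>i\<in>multi_indices d k. \<xi> i * of_real (T i j))"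

definition row_left_mult :: "'a::real_field vec \<Rightarrow> real mat \<Rightarrow> 'a mat" where
  "row_left_mult v M = mat_of_row v * map_mat of_real M"

end

theory Submission
  imports Defs
begin

text \<open>Flattening multi-indices by \<open>index_map\<close> is a bijection, so it only relabels
  coordinates. Since the basis functions are tensor products enumerated by the same map, each EDMD
  matrix is its EDMD tensor with both groups of indices flattened; \<open>matricizes\<close> records
  this relation. Under it the tensor and the row-vector left products are the same finite sum with
  relabelled terms (\<open>row_left_mult_vectorize\<close>), so the two eigenvalue equations agree
  coordinate by coordinate (\<open>tensor_eigen_iff_matrix_eigen\<close>). Nothing about the data
  enters beyond \<open>matricizes_edmd_A\<close>, and the scalars may come from any
  \<open>real_field\<close>.\<close>

definition matricizes ::
    "nat \<Rightarrow> (nat \<Rightarrow> nat) \<Rightarrow> ((nat \<Rightarrow> nat) \<Rightarrow> (nat \<Rightarrow> nat) \<Rightarrow> 'a) \<Rightarrow> 'a mat \<Rightarrow> bool" where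
  "matricizes d k T M \<longleftrightarrow> M \<in> carrier_mat (khat d k) (khat d k) \<and>
     (\<forall>i\<in>multi_indices d k. \<forall>j\<in>multi_indices d k.
        M $$ (index_map d k i - 1, index_map d k j - 1) = T i j)"

text \<open>Bridges the numbering from 1 of \<open>index_map\<close> and the numbering from 0 of
  \<open>vec\<close> and \<open>mat\<close> entries.\<close>

lemma bij_betw_index_map_minus_one:
  "bij_betw (\<lambda>i. index_map d k i - 1) (multi_indices d k) {0..<khat d k}"
proof -
  have "bij_betw (\<lambda>n. n - 1) {1..khat d k} {0..<khat d k}"
    by (rule bij_betw_byWitness[where f' = Suc]) auto
  then show ?thesis
    using bij_betw_trans[OF bij_betw_index_map] by (force simp: comp_def)
qed

lemma index_map_minus_one_less:
  "i \<in> multi_indices d k \<Longrightarrow> index_map d k i - 1 < khat d k"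
  using bij_betw_index_map_minus_one[of d k] by (auto dest: bij_betwE)

text \<open>Surjectivity of the flattening: a condition checked at the flattened multi-indices is
  checked at every column.\<close>

lemma ball_less_khat_iff:
  "(\<forall>c<khat d k. P c) \<longleftrightarrow> (\<forall>j\<in>multi_indices d k. P (index_map d k j - 1))"
proof -
  have "(\<forall>c<khat d k. P c) \<longleftrightarrow> (\<forall>c\<in>(\<lambda>j. index_map d k j - 1) ` multi_indices d k. P c)"
    using bij_betw_imp_surj_on[OF bij_betw_index_map_minus_one, of d k] by auto
  then show ?thesis by simp
qed

text \<open>The leading summand 1 in \<open>index_map\<close> keeps the natural-number subtraction
  from truncating, for every \<open>i\<close>.\<close>

lemma Suc_index_map_minus_one: "Suc (index_map d k i - 1) = index_map d k i"
  by (simp add: index_map_def)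

lemma row_left_mult_carrier:
  "v \<in> carrier_vec n \<Longrightarrow> M \<in> carrier_mat n c \<Longrightarrow> row_left_mult v M \<in> carrier_mat 1 c"
  by (auto simp: row_left_mult_def)

lemma vectorize_carrier: "vectorize d k \<xi> \<in> carrier_vec (khat d k)"
  by (simp add: vectorize_def)

lemma row_left_mult_vectorize:
  fixes \<xi> :: "(nat \<Rightarrow> nat) \<Rightarrow> 'a::real_field"
  assumes M: "matricizes d k T M" and j: "j \<in> multi_indices d k"
  shows "row_left_mult (vectorize d k \<xi>) M $$ (0, index_map d k j - 1) = tensor_left_mult d k \<xi> T j"
proof -
  let ?v = "vectorize d k \<xi>" and ?f = "\<lambda>i. index_map d k i - 1"
  have M_car: "M \<in> carrier_mat (khat d k) (khat d k)"
    using M by (simp add: matricizes_def)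
  have "row_left_mult ?v M $$ (0, ?f j) = (\<Sum>r\<in>{0..<khat d k}. ?v $ r * of_real (M $$ (r, ?f j)))"
    using M_car vectorize_carrier[of d k \<xi>] index_map_minus_one_less[OF j]
    by (simp add: row_left_mult_def scalar_prod_def mat_of_row_def)
  \<comment> \<open>The sum over rows becomes a sum over multi-indices, by reindexing along the
    bijection.\<close>
  also have "\<dots> = (\<Sum>i\<in>multi_indices d k. ?v $ ?f i * of_real (M $$ (?f i, ?f j)))"
    by (rule sum.reindex_bij_betw[OF bij_betw_index_map_minus_one, symmetric])
  also have "\<dots> = tensor_left_mult d k \<xi> T j"
    using M j unfolding tensor_left_mult_def matricizes_def
    by (intro sum.cong) (simp_all only: vectorize_index_map)
  finally show ?thesis .
qed

lemma tensor_eigen_iff_matrix_eigen: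
  fixes \<xi> :: "(nat \<Rightarrow> nat) \<Rightarrow> 'a::real_field"
  assumes A: "matricizes d k TA A" and G: "matricizes d k TG G"
  shows "(\<forall>j\<in>multi_indices d k. tensor_left_mult d k \<xi> TA j = lam * tensor_left_mult d k \<xi> TG j)
    \<longleftrightarrow> row_left_mult (vectorize d k \<xi>) A = lam \<cdot>\<^sub>m row_left_mult (vectorize d k \<xi>) G"
proof -
  let ?a = "row_left_mult (vectorize d k \<xi>) A" and ?g = "row_left_mult (vectorize d k \<xi>) G"
  have car: "?a \<in> carrier_mat 1 (khat d k)" "?g \<in> carrier_mat 1 (khat d k)"
    using A G row_left_mult_carrier[OF vectorize_carrier] by (auto simp: matricizes_def)
  \<comment> \<open>Both sides are matrices with a single row, so only the entries of row 0 have to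
    be compared.\<close>
  then have "?a = lam \<cdot>\<^sub>m ?g \<longleftrightarrow> (\<forall>c<khat d k. ?a $$ (0, c) = lam * ?g $$ (0, c))"
    by (auto simp: mat_eq_iff)
  then show ?thesis
    by (simp add: ball_less_khat_iff row_left_mult_vectorize[OF A] row_left_mult_vectorize[OF G]
        del: One_nat_def)
qed

lemma basis_vec_index_map:
  assumes "\<forall>i\<in>multi_indices d k. \<forall>z\<in>carrier_vec d. \<psi> (index_map d k i) z = basis_tensor d \<phi> i z"
    and "i \<in> multi_indices d k" "z \<in> carrier_vec d"
  shows "basis_vec (khat d k) \<psi> z $ (index_map d k i - 1) = basis_tensor d \<phi> i z"
  using assms index_map_minus_one_less[of i d k]
  by (simp add: basis_vec_def Suc_index_map_minus_one[simplified])

text \<open>At flattened indices the two averages over the data agree term by term. The points must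
  lie in \<open>carrier_vec d\<close>, where the tensor product form is given.\<close>

lemma matricizes_edmd_A:
  assumes "\<forall>i\<in>multi_indices d k. \<forall>z\<in>carrier_vec d. \<psi> (index_map d k i) z = basis_tensor d \<phi> i z"
    and "\<forall>l\<in>{1..m}. x l \<in> carrier_vec d" "\<forall>l\<in>{1..m}. y l \<in> carrier_vec d"
  shows "matricizes d k (edmd_tensor_A d \<phi> m x y) (edmd_mat_A (khat d k) \<psi> m x y)"
  using assms(2,3) index_map_minus_one_less[of _ d k]
  by (simp add: matricizes_def edmd_tensor_A_def edmd_mat_A_def basis_vec_index_map[OF assms(1)]
      del: One_nat_def)

text \<open>The Gram object is the case of the identity dynamics, \<open>y = x\<close>, so
  \<open>matricizes_edmd_A\<close> covers it too.\<close>

lemma edmd_tensor_G_eq_A: "edmd_tensor_G d \<phi> m x = edmd_tensor_A d \<phi> m x x"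
  by (intro ext) (simp add: edmd_tensor_A_def edmd_tensor_G_def)

lemma edmd_mat_G_eq_A: "edmd_mat_G K \<psi> m x = edmd_mat_A K \<psi> m x x"
  by (simp add: edmd_mat_A_def edmd_mat_G_def)

theorem proposition4p5:
  fixes d m :: nat
    and k :: "nat \<Rightarrow> nat"
    and X :: "real vec set"
    and S :: "real vec \<Rightarrow> real vec"
    and x y :: "nat \<Rightarrow> real vec"
    and \<phi> :: "nat \<Rightarrow> nat \<Rightarrow> real \<Rightarrow> real"
    and \<psi> :: "nat \<Rightarrow> real vec \<Rightarrow> real"
  assumes "X \<subseteq> carrier_vec d"
    and "S \<in> X \<rightarrow> X"
    and "m \<ge> 1"
    and "\<forall>l\<in>{1..m}. x l \<in> X"
    and "\<forall>l\<in>{1..m}. y l = S (x l)"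
    and tensor_product_form:
      "\<forall>i\<in>multi_indices d k. \<forall>z\<in>carrier_vec d. \<psi> (index_map d k i) z = basis_tensor d \<phi> i z"
  shows
    "(\<forall>(\<xi> :: (nat \<Rightarrow> nat) \<Rightarrow> real) (lam :: real).
        (\<forall>j\<in>multi_indices d k.
            tensor_left_mult d k \<xi> (edmd_tensor_A d \<phi> m x y) j
              = lam * tensor_left_mult d k \<xi> (edmd_tensor_G d \<phi> m x) j)
        \<longleftrightarrow>
        row_left_mult (vectorize d k \<xi>) (edmd_mat_A (khat d k) \<psi> m x y)
          = lam \<cdot>\<^sub>m row_left_mult (vectorize d k \<xi>) (edmd_mat_G (khat d k) \<psi> m x))
     \<and>
     (\<forall>(\<xi> :: (nat \<Rightarrow> nat) \<Rightarrow> complex) (lam :: complex).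
        (\<forall>j\<in>multi_indices d k.
            tensor_left_mult d k \<xi> (edmd_tensor_A d \<phi> m x y) j
              = lam * tensor_left_mult d k \<xi> (edmd_tensor_G d \<phi> m x) j)
        \<longleftrightarrow>
        row_left_mult (vectorize d k \<xi>) (edmd_mat_A (khat d k) \<psi> m x y)
          = lam \<cdot>\<^sub>m row_left_mult (vectorize d k \<xi>) (edmd_mat_G (khat d k) \<psi> m x))"
proof -
  have x: "\<forall>l\<in>{1..m}. x l \<in> carrier_vec d"
    using assms(1,4) by blast
  \<comment> \<open>As \<open>S\<close> maps \<open>X\<close> into itself, the images stay where the
    tensor product form applies.\<close>
  have y: "\<forall>l\<in>{1..m}. y l \<in> carrier_vec d"
    using assms(1,2,4,5) by auto
  have A: "matricizes d k (edmd_tensor_A d \<phi> m x y) (edmd_mat_A (khat d k) \<psi> m x y)"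
    by (rule matricizes_edmd_A[OF tensor_product_form x y])
  have G: "matricizes d k (edmd_tensor_G d \<phi> m x) (edmd_mat_G (khat d k) \<psi> m x)"
    unfolding edmd_tensor_G_eq_A edmd_mat_G_eq_A
    by (rule matricizes_edmd_A[OF tensor_product_form x x])
  \<comment> \<open>The two conjuncts are the real and the complex instance of one
    equivalence.\<close>
  show ?thesis
    by (intro conjI allI tensor_eigen_iff_matrix_eigen[OF A G])
qed

end
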